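(* Let $n\ge 3$ and let $\{\mathcal{G}_N\}$ be a family of weighted directed graphs of increasing size $N$ such that the sequence $\mathrm{Re}\{\lambda_2(\mathcal{G}_N)\}\to 0$ as $N\to\infty$. Then no control of the form $$u_i=-\sum_{k=0}^{n-1}a_k\sum_{j\in\mathcal{N}_i}w_{ij}\,(x_i^{(k)}-x_j^{(k)}),\qquad i=1,\dots,N,$$ with gains $a_k>0$, $k=0,\dots,n-1$, that are finite and fixed (in particular independent of $N$ and of the graph within the family), is scalably stable in $\{\mathcal{G}_N\}$. That is, for every such choice of gains there is a graph in the family over which the closed-loop system does not achieve consensus.
   Context: Graphs: $\mathcal{G}_N=\{\mathcal{V}_N,\mathcal{E}_N\}$ has $N=|\mathcal{V}_N|$ nodes and directed edges $\mathcal{E}_N\subset\mathcal{V}_N\times\mathcal{V}_N$; each edge $(i,j)$ carries a nonnegative weight $w_{ij}$ (with $w_{ij}=0$ if $(i,j)\notin\mathcal{E}_N$). The neighbor set of node $i$ is $\mathcal{N}_i=\{j:(i,j)\in\mathcal{E}_N\}$. A graph family $\{\mathcal{G}_N\}$ is a sequence of graphs in which the size $N$ is increasing (to infinity); $\mathcal{G}_N$ need not be a subgraph of $\mathcal{G}_{N+1}$. Laplacian: $L$ has entries $[L]_{ij}=-w_{ij}$ if $j\ne i$ and $j\in\mathcal{N}_i$, $[L]_{ii}=\sum_{k\in\mathcal{N}_i}w_{ik}$, and $0$ otherwise. Its eigenvalues, counted with multiplicity, are $\lambda_1(\mathcal{G}_N),\dots,\lambda_N(\mathcal{G}_N)$,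 numbered so that $\lambda_1=0$ and $0\le\mathrm{Re}\{\lambda_2\}\le\dots\le\mathrm{Re}\{\lambda_N\}$. Dynamics: each agent $i\in\mathcal{V}_N$ has a scalar state $x_i(t)\in\mathbb{R}$ obeying $\frac{d}{dt}x_i^{(k)}=x_i^{(k+1)}$ for $k=0,\dots,n-2$ and $\frac{d}{dt}x_i^{(n-1)}=u_i$, where $x_i^{(k)}$ denotes the $k$-th time derivative of $x_i$ and $x_i^{(0)}=x_i$. Consensus and scalable stability: the closed-loop system achieves consensus if $x_i^{(k)}(t)-x_j^{(k)}(t)\to 0$ as $t\to\infty$ for all $i,j\in\mathcal{V}_N$, all $k=0,\dots,n-1$, and any initial state. A control design is scalably stable in $\{\mathcal{G}_N\}$ if the resulting closed-loop system achieves consensus over every graph in the family. *)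

theory Defs
  imports
    "HOL-Analysis.Analysis"
    "Jordan_Normal_Form.Char_Poly"
    "Graph_Theory.Pair_Digraph"
begin

record weighted_digraph =
  graph :: "nat pair_pre_digraph"
  weight :: "nat \<Rightarrow> nat \<Rightarrow> real"

abbreviation nodes :: "weighted_digraph \<Rightarrow> nat set" where
  "nodes G \<equiv> pverts (graph G)"

abbreviation edges :: "weighted_digraph \<Rightarrow> (nat \<times> nat) set" where
  "edges G \<equiv> parcs (graph G)"

definition size_of :: "weighted_digraph \<Rightarrow> nat" where
  "size_of G = card (nodes G)"

definition nbrs :: "weighted_digraph \<Rightarrow> nat \<Rightarrow> nat set" where
  "nbrs G i = {j. (i, j) \<in> edges G}"

text \<open>
  The \<open>N\<close> nodes are labelled \<open>0, \<dots>, N - 1\<close>, matching the index range of \<open>N \<times> N\<close> matrices.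
  The locale \<^locale>\<open>pair_digraph\<close> (finite, no parallel arcs) also excludes self-loops. With the
  Laplacian below, a self-loop of positive weight would contribute to the diagonal entry only, and
  the row sums would no longer vanish, so \<open>0\<close> need not be an eigenvalue.
\<close>

definition wf_weighted_digraph :: "weighted_digraph \<Rightarrow> bool" where
  "wf_weighted_digraph G \<longleftrightarrow>
     pair_digraph (graph G) \<and>
     nodes G = {..<size_of G} \<and>
     (\<forall>(i, j) \<in> edges G. weight G i j \<ge> 0) \<and>
     (\<forall>i j. (i, j) \<notin> edges G \<longrightarrow> weight G i j = 0)"

definition graph_family :: "(nat \<Rightarrow> weighted_digraph) \<Rightarrow> bool" where
  "graph_family \<G> \<longleftrightarrow>
     (\<forall>m. wf_weighted_digraph (\<G> m)) \<and> strict_mono (\<lambda>m. size_of (\<G> m))"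

definition laplacian :: "weighted_digraph \<Rightarrow> real mat" where
  "laplacian G = mat (size_of G) (size_of G) (\<lambda>(i, j).
     if j = i then (\<Sum>k\<in>nbrs G i. weight G i k)
     else if j \<in> nbrs G i then - weight G i j
     else 0)"

text \<open>
  \<open>l 1, \<dots>, l N\<close> are the complex eigenvalues of the Laplacian, counted with algebraic multiplicity,
  in the order \<open>l 1 = 0\<close> and \<open>0 \<le> Re (l 2) \<le> \<dots> \<le> Re (l N)\<close>. The order determines
  \<open>Re (l 2)\<close> uniquely when \<open>N \<ge> 2\<close>; the values of \<open>l\<close> at indices \<open>k > N\<close> are irrelevant.
\<close>

definition laplacian_eigenvalues :: "weighted_digraph \<Rightarrow> (nat \<Rightarrow> complex) \<Rightarrow> bool" where
  "laplacian_eigenvalues G l \<longleftrightarrow>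
     char_poly (map_mat complex_of_real (laplacian G)) = (\<Prod>k = 1..size_of G. [:- l k, 1:]) \<and>
     l 1 = 0 \<and>
     (\<forall>k \<in> {2..size_of G}. 0 \<le> Re (l k)) \<and>
     (\<forall>j k. 2 \<le> j \<and> j \<le> k \<and> k \<le> size_of G \<longrightarrow> Re (l j) \<le> Re (l k))"

text \<open>
  A state assigns to agent \<open>i\<close> and order \<open>k < n\<close> the value of the \<open>k\<close>-th derivative; a control
  design assigns to each graph and state the input of every agent. In a trajectory, \<open>x t i k\<close> is
  the \<open>k\<close>-th time derivative of the position of agent \<open>i\<close> at time \<open>t\<close>.
\<close>

type_synonym state = "nat \<Rightarrow> nat \<Rightarrow> real"
type_synonym control = "weighted_digraph \<Rightarrow> state \<Rightarrow> nat \<Rightarrow> real"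

definition closed_loop :: "nat \<Rightarrow> control \<Rightarrow> weighted_digraph \<Rightarrow> (real \<Rightarrow> state) \<Rightarrow> bool" where
  "closed_loop n u G x \<longleftrightarrow>
     (\<forall>i \<in> nodes G. \<forall>t \<ge> 0.
        (\<forall>k. k + 1 < n \<longrightarrow>
           ((\<lambda>s. x s i k) has_real_derivative x t i (k + 1)) (at t within {0..})) \<and>
        ((\<lambda>s. x s i (n - 1)) has_real_derivative u G (x t) i) (at t within {0..}))"

text \<open>Every initial state is covered by quantifying over all trajectories on \<open>[0, \<infinity>)\<close>.\<close>

definition achieves_consensus :: "nat \<Rightarrow> control \<Rightarrow> weighted_digraph \<Rightarrow> bool" where
  "achieves_consensus n u G \<longleftrightarrow>
     (\<forall>x. closed_loop n u G x \<longrightarrow>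
        (\<forall>i \<in> nodes G. \<forall>j \<in> nodes G. \<forall>k < n. ((\<lambda>t. x t i k - x t j k) \<longlongrightarrow> 0) at_top))"

definition scalably_stable :: "nat \<Rightarrow> control \<Rightarrow> (nat \<Rightarrow> weighted_digraph) \<Rightarrow> bool" where
  "scalably_stable n u \<G> \<longleftrightarrow> (\<forall>m. achieves_consensus n u (\<G> m))"

definition consensus_control :: "nat \<Rightarrow> (nat \<Rightarrow> real) \<Rightarrow> control" where
  "consensus_control n a G x i =
     - (\<Sum>k = 0..n - 1. a k * (\<Sum>j\<in>nbrs G i. weight G i j * (x i k - x j k)))"

end

theory Submission
  imports Defs
begin

text \<open>
  Let \<open>\<mu>\<close> be an eigenvalue of the Laplacian with eigenvector \<open>v\<close>. If \<open>s\<close> is a root of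
  \<open>s\<^sup>n + \<mu> (a\<^sub>0 + a\<^sub>1 s + \<dots> + a\<^bsub>n-1\<^esub> s\<^bsup>n-1\<^esup>)\<close>, then \<open>x\<^sub>i(t) = Re (exp (s t) v\<^sub>i)\<close> solves the
  closed loop. When \<open>Re s \<ge> 0\<close> and \<open>v\<close> is not constant over the nodes, the differences between
  agents do not all decay for this solution or for the one from \<open>- \<i> v\<close>, so consensus fails. It remains to find such \<open>v\<close> and \<open>s\<close> for
  \<open>\<mu> = \<lambda>\<^sub>2\<close> on some graph of the family.

  The difficulty with the root is that only \<open>Re \<lambda>\<^sub>2\<close> becomes small: the imaginary part may be
  arbitrarily large, so perturbing \<open>s\<^sup>n\<close> does not suffice. A generalized Routh--Hurwitz condition
  for complex coefficients is uniform in \<open>Im \<mu>\<close>. For a monic polynomial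
  \<open>s\<^sup>n + e\<^sub>1 s\<^bsup>n-1\<^esup> + e\<^sub>2 s\<^bsup>n-2\<^esup> + e\<^sub>3 s\<^bsup>n-3\<^esup> + \<dots>\<close> with all roots in the closed left half-plane,
  the second leading minor of the Hermite form,
  \<open>Re e\<^sub>1 (Re (e\<^sub>2 cnj e\<^sub>1) - Re e\<^sub>3) - (Im e\<^sub>2)\<^sup>2\<close>, is nonnegative (\<open>stable_poly_minor_nonneg\<close>).
  Here \<open>e\<^sub>k = \<mu> c\<^sub>k\<close> with \<open>c\<^sub>k = a\<^bsub>n-k\<^esub>\<close>, and the minor equals
  \<open>(Re \<mu>)\<^sup>2 c\<^sub>1 (Re \<mu> c\<^sub>1 c\<^sub>2 - c\<^sub>3) + (Im \<mu>)\<^sup>2 c\<^sub>2 (Re \<mu> c\<^sub>1\<^sup>2 - c\<^sub>2)\<close>.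
  For small \<open>Re \<mu>\<close> both brackets are negative, whatever \<open>Im \<mu>\<close> is. Hence some root has positive
  real part unless \<open>\<mu> = 0\<close>, where \<open>s = 0\<close> is a root (\<open>consensus_poly_unstable_root\<close>). The
  coefficient \<open>c\<^sub>3\<close> exists precisely because \<open>n \<ge> 3\<close>.

  For the eigenvector (\<open>nonconstant_laplacian_eigenvector\<close>), the case \<open>\<lambda>\<^sub>2 = 0\<close> needs care: the
  algebraic multiplicity of \<open>0\<close> must be turned into a second eigenvector. The Laplacian acts on
  the quotient by the constant vectors with eigenvalues \<open>\<lambda>\<^sub>2, \<dots>, \<lambda>\<^sub>N\<close>, which yields a nonconstant
  \<open>v\<close> with \<open>L v = \<lambda>\<^sub>2 v + c 1\<close>. If \<open>\<lambda>\<^sub>2 \<noteq> 0\<close>, adding a constant to \<open>v\<close> removes \<open>c\<close>; if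
  \<open>\<lambda>\<^sub>2 = 0\<close>, the maximum principle forces \<open>c = 0\<close>.
\<close>

section \<open>Deflating the eigenvalue of the constant vectors\<close>

text \<open>
  The matrix on the right represents \<open>L\<close> on the quotient by the constant vectors, in the
  coordinates \<open>x\<^sub>i - x\<^sub>0\<close> for \<open>i > 0\<close>. Replacing the first basis vector by the all-ones vector makes
  \<open>L\<close> block triangular with this matrix in the lower corner and \<open>0\<close> in the upper one.
\<close>

lemma char_poly_zero_row_sums:
  fixes L :: "'a::field mat"
  assumes L: "L \<in> carrier_mat (Suc m) (Suc m)"
    and rows: "\<And>i. i < Suc m \<Longrightarrow> (\<Sum>j<Suc m. L $$ (i, j)) = 0"
  shows "char_poly L = [:0, 1:] * char_poly (mat m m (\<lambda>(i, j). L $$ (Suc i, Suc j) - L $$ (0, Suc j)))"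
    (is "_ = _ * char_poly ?R")
proof -
  define one where "one = mat m 1 (\<lambda>_. 1 :: 'a)"
  define P where "P = four_block_mat (1\<^sub>m 1) (0\<^sub>m 1 m) one (1\<^sub>m m)"
  define Q where "Q = four_block_mat (1\<^sub>m 1) (0\<^sub>m 1 m) (- one) (1\<^sub>m m)"
  define b where "b = mat 1 m (\<lambda>(i, j). L $$ (0, Suc j))"
  define D where "D = mat m m (\<lambda>(i, j). L $$ (Suc i, Suc j))"
  define T where "T = four_block_mat (0\<^sub>m 1 1) b (0\<^sub>m m 1) ?R"
  have carr: "one \<in> carrier_mat m 1" "b \<in> carrier_mat 1 m" "D \<in> carrier_mat m m"
    "?R \<in> carrier_mat m m"
    by (auto simp: one_def b_def D_def)
  have PQc: "P \<in> carrier_mat (Suc m) (Suc m)" "Q \<in> carrier_mat (Suc m) (Suc m)"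
    "T \<in> carrier_mat (Suc m) (Suc m)"
    using carr by (auto simp: P_def Q_def T_def)
  have "P * Q = 1\<^sub>m (1 + m)"
    unfolding P_def Q_def using carr
    by (subst mult_four_block_mat[of _ 1 1 _ m _ m]) (auto simp: one_def intro!: eq_matI)
  hence PQ: "P * Q = 1\<^sub>m (Suc m)" by simp
  have "Q * P = 1\<^sub>m (1 + m)"
    unfolding P_def Q_def using carr
    by (subst mult_four_block_mat[of _ 1 1 _ m _ m]) (auto simp: one_def intro!: eq_matI)
  hence QP: "Q * P = 1\<^sub>m (Suc m)" by simp
  have LP: "L * P = four_block_mat (0\<^sub>m 1 1) b (0\<^sub>m m 1) D"
  proof (rule eq_matI)
    fix i j
    assume "i < dim_row (four_block_mat (0\<^sub>m 1 1) b (0\<^sub>m m 1) D)"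
      and "j < dim_col (four_block_mat (0\<^sub>m 1 1) b (0\<^sub>m m 1) D)"
    hence ij: "i < Suc m" "j < Suc m" using carr by auto
    have P_entry: "P $$ (k, j) = (if j = 0 \<or> k = j then 1 else 0)" if "k < Suc m" for k
      using that ij carr by (auto simp: P_def one_def)
    have "(L * P) $$ (i, j) = (\<Sum>k<Suc m. L $$ (i, k) * P $$ (k, j))"
      using ij L PQc by (auto simp: scalar_prod_def atLeast0LessThan)
    also have "\<dots> = (\<Sum>k<Suc m. L $$ (i, k) * (if j = 0 \<or> k = j then 1 else 0))"
      by (intro sum.cong) (auto simp: P_entry)
    also have "\<dots> = (if j = 0 then 0 else L $$ (i, j))"
    proof (cases "j = 0")
      case True
      thus ?thesis using rows[OF ij(1)] by simp
    next
      case False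
      have "(\<Sum>k<Suc m. L $$ (i, k) * (if j = 0 \<or> k = j then 1 else 0)) =
        (\<Sum>k<Suc m. if k = j then L $$ (i, k) else 0)"
        using False by (intro sum.cong) auto
      thus ?thesis using False ij by (simp del: sum.lessThan_Suc)
    qed
    also have "\<dots> = four_block_mat (0\<^sub>m 1 1) b (0\<^sub>m m 1) D $$ (i, j)"
      using ij carr by (auto simp: b_def D_def)
    finally show "(L * P) $$ (i, j) = four_block_mat (0\<^sub>m 1 1) b (0\<^sub>m m 1) D $$ (i, j)" .
  qed (use L PQc carr in auto)
  have "- one * b + D = ?R"
    by (rule eq_matI) (auto simp: one_def b_def D_def scalar_prod_def)
  hence "Q * (L * P) = T"
    unfolding LP Q_def T_def using carr
    by (subst mult_four_block_mat[of _ 1 1 _ m _ m]) (auto intro!: cong_four_block_mat)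
  hence "P * T * Q = P * (Q * (L * P)) * Q" by simp
  also have "\<dots> = (P * Q) * L * (P * Q)"
    using L PQc by (simp add: assoc_mult_mat[of _ "Suc m" "Suc m" _ "Suc m" _ "Suc m"])
  also have "\<dots> = L" using L by (simp add: PQ)
  finally have "similar_mat L T"
    using L PQc PQ QP by (intro similar_matI[of _ _ P Q "Suc m"]) auto
  hence "char_poly L = char_poly T" by (rule char_poly_similar)
  also have "\<dots> = char_poly (0\<^sub>m 1 1) * char_poly ?R"
    unfolding T_def using carr by (intro char_poly_four_block_zeros_col) auto
  also have "char_poly (0\<^sub>m 1 1 :: 'a mat) = [:0, 1:]"
    by (simp add: char_poly_defs det_def sign_def)
  finally show ?thesis .
qed

text \<open>
  Cancelling the factor for \<open>l 1 = 0\<close> leaves \<open>l 2\<close> as an eigenvalue on the quotient, even when it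
  is itself \<open>0\<close>. A quotient eigenvector lifts to \<open>v\<close> by setting \<open>v 0 = 0\<close>, at the price of the
  constant \<open>c\<close>.
\<close>

lemma eigenvector_modulo_constants:
  fixes L :: "'a::field mat"
  assumes L: "L \<in> carrier_mat N N"
    and N: "N \<ge> 2"
    and rows: "\<And>i. i < N \<Longrightarrow> (\<Sum>j<N. L $$ (i, j)) = 0"
    and cp: "char_poly L = (\<Prod>k = 1..N. [:- l k, 1:])"
    and l1: "l 1 = 0"
  obtains v c where "\<And>i. i < N \<Longrightarrow> (\<Sum>j<N. L $$ (i, j) * v j) = l 2 * v i + c"
    and "\<exists>i<N. \<exists>j<N. v i \<noteq> v j"
proof -
  obtain m where m: "N = Suc m" using N by (cases N) auto
  define R where "R = mat m m (\<lambda>(i, j). L $$ (Suc i, Suc j) - L $$ (0, Suc j))"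
  have R: "R \<in> carrier_mat m m" by (simp add: R_def)
  have "[:0, 1:] * char_poly R = (\<Prod>k = 1..N. [:- l k, 1:])"
    using char_poly_zero_row_sums[of L m] L rows cp by (simp add: m R_def)
  also have "\<dots> = [:- l 1, 1:] * (\<Prod>k = 2..N. [:- l k, 1:])"
    using N by (subst prod.atLeast_Suc_atMost) (auto simp: numeral_2_eq_2)
  finally have "char_poly R = (\<Prod>k = 2..N. [:- l k, 1:])"
    by (simp only: l1 minus_zero mult_left_cancel) simp
  hence "poly (char_poly R) (l 2) = 0"
    using N by (auto simp: poly_prod)
  then obtain w where w: "eigenvector R w (l 2)"
    using eigenvalue_root_char_poly[OF R] by (auto simp: eigenvalue_def)
  define v where "v i = (case i of 0 \<Rightarrow> 0 | Suc i \<Rightarrow> vec_index w i)" for i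
  define c where "c = (\<Sum>j<m. L $$ (0, Suc j) * vec_index w j)"
  have wc: "w \<in> carrier_vec m" "w \<noteq> 0\<^sub>v m" and Rw: "R *\<^sub>v w = l 2 \<cdot>\<^sub>v w"
    using w R by (auto simp: eigenvector_def)
  have sum_v: "(\<Sum>j<N. L $$ (i, j) * v j) = (\<Sum>j<m. L $$ (i, Suc j) * vec_index w j)" for i
    unfolding m sum.lessThan_Suc_shift by (simp add: v_def)
  have "(\<Sum>j<N. L $$ (i, j) * v j) = l 2 * v i + c" if "i < N" for i
  proof (cases i)
    case 0
    thus ?thesis unfolding sum_v by (simp add: v_def c_def)
  next
    case (Suc i')
    have "vec_index (R *\<^sub>v w) i' = (\<Sum>j<m. (L $$ (i, Suc j) - L $$ (0, Suc j)) * vec_index w j)"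
      using Suc that wc by (auto simp: m R_def scalar_prod_def atLeast0LessThan)
    also have "\<dots> = (\<Sum>j<m. L $$ (i, Suc j) * vec_index w j) - c"
      by (simp add: c_def left_diff_distrib sum_subtractf)
    finally show ?thesis unfolding sum_v Rw
      using Suc that wc by (auto simp: m v_def)
  qed
  moreover have "\<exists>i<m. vec_index w i \<noteq> 0"
  proof (rule ccontr)
    assume "\<not> (\<exists>i<m. vec_index w i \<noteq> 0)"
    hence "w = 0\<^sub>v m" using wc by (intro eq_vecI) auto
    thus False using wc by simp
  qed
  then obtain i where "i < m" "vec_index w i \<noteq> 0" by blast
  hence "\<exists>i<N. \<exists>j<N. v i \<noteq> v j"
    by (intro exI[of _ "Suc i"] conjI exI[of _ 0]) (auto simp: m v_def)
  ultimately show ?thesis using that by blast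
qed

section \<open>Eigenvectors of the graph Laplacian\<close>

lemma wf_nbrs:
  assumes "wf_weighted_digraph G"
  shows "nbrs G i \<subseteq> {..<size_of G}" "finite (nbrs G i)" "i \<notin> nbrs G i"
    and "j \<in> nbrs G i \<Longrightarrow> weight G i j \<ge> 0"
proof -
  interpret pair_digraph "graph G" using assms by (simp add: wf_weighted_digraph_def)
  have n: "nodes G = {..<size_of G}" using assms by (simp add: wf_weighted_digraph_def)
  show sub: "nbrs G i \<subseteq> {..<size_of G}"
    using in_arcsD2 unfolding n[symmetric] nbrs_def by blast
  thus "finite (nbrs G i)" by (rule finite_subset) simp
  show "i \<notin> nbrs G i" using no_loops by (force simp: nbrs_def)
  show "j \<in> nbrs G i \<Longrightarrow> weight G i j \<ge> 0"
    using assms by (auto simp: wf_weighted_digraph_def nbrs_def)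
qed

lemma laplacian_apply:
  fixes v :: "nat \<Rightarrow> complex"
  assumes wf: "wf_weighted_digraph G" and i: "i < size_of G"
  shows "(\<Sum>j<size_of G. map_mat complex_of_real (laplacian G) $$ (i, j) * v j) =
    (\<Sum>j\<in>nbrs G i. complex_of_real (weight G i j) * (v i - v j))"
proof -
  note nb = wf_nbrs[OF wf, of i]
  let ?S = "\<Sum>k\<in>nbrs G i. complex_of_real (weight G i k)"
  have "(\<Sum>j<size_of G. map_mat complex_of_real (laplacian G) $$ (i, j) * v j) =
    (\<Sum>j<size_of G. (if j = i then ?S * v j else 0) -
      (if j \<in> nbrs G i then complex_of_real (weight G i j) * v j else 0))"
    using i nb by (intro sum.cong) (auto simp: laplacian_def)
  also have "\<dots> = ?S * v i - (\<Sum>j\<in>nbrs G i. complex_of_real (weight G i j) * v j)"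
    using i nb by (simp add: sum_subtractf sum.inter_restrict[symmetric] Int_absorb1)
  also have "\<dots> = (\<Sum>j\<in>nbrs G i. complex_of_real (weight G i j) * (v i - v j))"
    by (simp add: right_diff_distrib sum_subtractf sum_distrib_right)
  finally show ?thesis .
qed

text \<open>
  Maximum principle: the Laplacian of \<open>f\<close> is nonnegative at a maximum of \<open>f\<close> and nonpositive at a
  minimum, so no nonzero constant vector is in its image.
\<close>

lemma laplacian_constant_image_zero:
  fixes f :: "nat \<Rightarrow> real"
  assumes wf: "wf_weighted_digraph G" and ne: "size_of G > 0"
    and c: "\<And>i. i < size_of G \<Longrightarrow> (\<Sum>j\<in>nbrs G i. weight G i j * (f i - f j)) = c"
  shows "c = 0"
proof -
  let ?V = "{..<size_of G}"
  have V: "finite (f ` ?V)" "f ` ?V \<noteq> {}" using ne by auto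
  obtain p where p: "p < size_of G" "f p = Max (f ` ?V)" using Max_in[OF V] by auto
  obtain q where q: "q < size_of G" "f q = Min (f ` ?V)" using Min_in[OF V] by auto
  have "f j \<le> f p \<and> f q \<le> f j" if "j \<in> nbrs G i" for i j
    unfolding p q using that wf_nbrs(1)[OF wf, of i] V by auto
  hence "(\<Sum>j\<in>nbrs G p. weight G p j * (f p - f j)) \<ge> 0"
    "(\<Sum>j\<in>nbrs G q. weight G q j * (f q - f j)) \<le> 0"
    using wf_nbrs(4)[OF wf] by (auto intro!: sum_nonneg sum_nonpos mult_nonneg_nonneg mult_nonneg_nonpos)
  thus ?thesis using c[OF p(1)] c[OF q(1)] by simp
qed

lemma nonconstant_laplacian_eigenvector:
  assumes wf: "wf_weighted_digraph G" and N: "size_of G \<ge> 2"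
    and eig: "laplacian_eigenvalues G l"
  obtains v where "\<And>i. i < size_of G \<Longrightarrow>
      (\<Sum>j\<in>nbrs G i. complex_of_real (weight G i j) * (v i - v j)) = l 2 * v i"
    and "\<exists>i<size_of G. \<exists>j<size_of G. v i \<noteq> v j"
proof -
  let ?L = "map_mat complex_of_real (laplacian G)"
  have L: "?L \<in> carrier_mat (size_of G) (size_of G)" by (simp add: laplacian_def)
  have rows: "(\<Sum>j<size_of G. ?L $$ (i, j)) = 0" if "i < size_of G" for i
    using laplacian_apply[OF wf that, of "\<lambda>_. 1"] by simp
  have "char_poly ?L = (\<Prod>k = 1..size_of G. [:- l k, 1:])" "l 1 = 0"
    using eig by (auto simp: laplacian_eigenvalues_def)
  from eigenvector_modulo_constants[OF L N rows this] obtain v c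
    where "\<And>i. i < size_of G \<Longrightarrow> (\<Sum>j<size_of G. ?L $$ (i, j) * v j) = l 2 * v i + c"
      and nc: "\<exists>i<size_of G. \<exists>j<size_of G. v i \<noteq> v j" by blast
  hence v: "(\<Sum>j\<in>nbrs G i. complex_of_real (weight G i j) * (v i - v j)) = l 2 * v i + c"
    if "i < size_of G" for i using laplacian_apply[OF wf that, of v] that by simp
  show ?thesis
  proof (cases "l 2 = 0")
    case True
    have "Re c = 0"
    proof (rule laplacian_constant_image_zero[OF wf])
      show "(\<Sum>j\<in>nbrs G i. weight G i j * (Re (v i) - Re (v j))) = Re c" if "i < size_of G" for i
        using arg_cong[OF v[OF that], of Re] True by simp
    qed (use N in auto)
    moreover have "Im c = 0"
    proof (rule laplacian_constant_image_zero[OF wf])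
      show "(\<Sum>j\<in>nbrs G i. weight G i j * (Im (v i) - Im (v j))) = Im c" if "i < size_of G" for i
        using arg_cong[OF v[OF that], of Im] True by simp
    qed (use N in auto)
    ultimately have "c = 0" by (simp add: complex_eq_iff)
    thus ?thesis using that[OF _ nc] v by simp
  next
    case False
    \<comment> \<open>The shift leaves \<open>L v\<close> unchanged and raises \<open>l 2 * v i\<close> by exactly \<open>c\<close>.\<close>
    define u where "u i = v i + c / l 2" for i
    have "(\<Sum>j\<in>nbrs G i. complex_of_real (weight G i j) * (u i - u j)) = l 2 * u i"
      if "i < size_of G" for i
    proof -
      have "u i - u j = v i - v j" for j by (simp add: u_def)
      thus ?thesis using v[OF that] False by (simp add: u_def distrib_left)
    qed
    thus ?thesis using that[of u] nc by (auto simp: u_def)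
  qed
qed

section \<open>A necessary condition for stability of complex polynomials\<close>

text \<open>
  Put \<open>P(z) = \<Prod> (1 + r z)\<close> and let \<open>Q(z)\<close> be \<open>P(- z)\<close> with conjugated coefficients. The Hermite form
  of \<open>P\<close> has the generating function \<open>(P(z) cnj (P w) - Q(z) cnj (Q w)) / (z + cnj w)\<close>. If
  \<open>P = 1 + e\<^sub>1 z + e\<^sub>2 z\<^sup>2 + e\<^sub>3 z\<^sup>3 + \<dots>\<close>, its leading two-by-two block is, up to a factor two, the
  Hermitian matrix with diagonal \<open>A = Re e\<^sub>1\<close>, \<open>C = Re (e\<^sub>2 cnj e\<^sub>1) - Re e\<^sub>3\<close> and off-diagonal
  entries \<open>- \<i> B\<close> and \<open>\<i> B\<close>, where \<open>B = Im e\<^sub>2\<close>. Multiplying \<open>P\<close> by \<open>1 + r z\<close> with \<open>r = \<rho> + \<i> \<sigma>\<close> acts on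
  this block by a unimodular congruence followed by adding \<open>\<rho>\<close> times a rank-one square. The next
  lemma is that step in real coordinates, with \<open>b = Im e\<^sub>1\<close>: it preserves positive semidefiniteness
  when \<open>\<rho> \<ge> 0\<close>.
\<close>

lemma hermite_minor_step:
  fixes A B C b \<rho> \<sigma> :: real
  assumes "A \<ge> 0" "C \<ge> 0" "B\<^sup>2 \<le> A * C" "\<rho> \<ge> 0"
  defines "C' \<equiv> C + 2 * \<sigma> * B + \<rho> * (A\<^sup>2 + b\<^sup>2) + (\<rho>\<^sup>2 + \<sigma>\<^sup>2) * A"
  shows "C' \<ge> 0" "(B + \<sigma> * A + \<rho> * b)\<^sup>2 \<le> (A + \<rho>) * C'"
proof -
  \<comment> \<open>Semidefiniteness of the adjugate block; the new corner, and the growth of the determinant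
    divided by \<open>\<rho>\<close>, are values of this form plus evidently nonnegative terms.\<close>
  have form: "C + 2 * B * w + A * w\<^sup>2 \<ge> 0" for w
  proof (cases "A = 0")
    case True
    thus ?thesis using assms by simp
  next
    case False
    have "A * (C + 2 * B * w + A * w\<^sup>2) = (A * w + B)\<^sup>2 + (A * C - B\<^sup>2)"
      by (simp add: power2_eq_square algebra_simps)
    also have "\<dots> \<ge> 0" using assms by simp
    finally show ?thesis using False assms(1) by (simp add: zero_le_mult_iff)
  qed
  have "C' = (C + 2 * B * \<sigma> + A * \<sigma>\<^sup>2) + (\<rho> * (A\<^sup>2 + b\<^sup>2) + \<rho>\<^sup>2 * A)"
    by (simp add: C'_def algebra_simps)
  thus "C' \<ge> 0" using form[of \<sigma>] assms(1,4) by simp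
  have "(A + \<rho>) * C' - (B + \<sigma> * A + \<rho> * b)\<^sup>2 =
    (A * C - B\<^sup>2) + \<rho> * ((C + 2 * B * (\<sigma> - b) + A * (\<sigma> - b)\<^sup>2) + A * (\<rho> + A)\<^sup>2)"
    by (simp add: C'_def power2_eq_square algebra_simps)
  moreover have "\<dots> \<ge> 0" using form[of "\<sigma> - b"] assms(1,3,4) by simp
  ultimately show "(B + \<sigma> * A + \<rho> * b)\<^sup>2 \<le> (A + \<rho>) * C'" by simp
qed

text \<open>
  Starting from the zero block of the empty product, each factor preserves semidefiniteness. The
  two diagonal bounds are what the induction needs besides the determinant.
\<close>

lemma hermite_minor_nonneg:
  fixes rs :: "complex list"
  assumes "\<And>r. r \<in> set rs \<Longrightarrow> Re r \<ge> 0"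
  defines "e \<equiv> coeff (\<Prod>r\<leftarrow>rs. [:1, r:])"
  shows "e 0 = 1 \<and> Re (e 1) \<ge> 0 \<and> Re (e 2 * cnj (e 1)) - Re (e 3) \<ge> 0 \<and>
    (Im (e 2))\<^sup>2 \<le> Re (e 1) * (Re (e 2 * cnj (e 1)) - Re (e 3))"
  using assms(1) unfolding e_def
proof (induction rs)
  case Nil
  show ?case by (simp add: numeral_2_eq_2 numeral_3_eq_3)
next
  case (Cons r rs)
  define f where "f = coeff (\<Prod>r\<leftarrow>rs. [:1, r:])"
  define g where "g = coeff (\<Prod>r\<leftarrow>r # rs. [:1, r:])"
  define C where "C = Re (f 2 * cnj (f 1)) - Re (f 3)"
  have IH: "f 0 = 1" "Re (f 1) \<ge> 0" "C \<ge> 0" "(Im (f 2))\<^sup>2 \<le> Re (f 1) * C"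
    using Cons by (auto simp: f_def C_def)
  have r: "Re r \<ge> 0" using Cons.prems by simp
  have g: "g 0 = 1" "g 1 = f 1 + r" "g 2 = f 2 + r * f 1" "g 3 = f 3 + r * f 2"
    using IH(1) by (auto simp: g_def f_def numeral_2_eq_2 numeral_3_eq_3 mult.commute)
  have "Re (g 2 * cnj (g 1)) - Re (g 3) = C + 2 * Im r * Im (f 2) +
      Re r * ((Re (f 1))\<^sup>2 + (Im (f 1))\<^sup>2) + ((Re r)\<^sup>2 + (Im r)\<^sup>2) * Re (f 1)"
    unfolding g C_def by (simp add: power2_eq_square algebra_simps)
  moreover have "Im (g 2) = Im (f 2) + Im r * Re (f 1) + Re r * Im (f 1)"
    unfolding g by simp
  moreover have "Re (g 1) = Re (f 1) + Re r" unfolding g by simp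
  ultimately have "g 0 = 1 \<and> Re (g 1) \<ge> 0 \<and> Re (g 2 * cnj (g 1)) - Re (g 3) \<ge> 0 \<and>
    (Im (g 2))\<^sup>2 \<le> Re (g 1) * (Re (g 2 * cnj (g 1)) - Re (g 3))"
    using hermite_minor_step[OF IH(2,3,4) r, of "Im r" "Im (f 1)"] IH r g(1) by simp
  thus ?case unfolding g_def .
qed

text \<open>
  Reversing the coefficients of \<open>\<Prod> (z - s)\<close> gives \<open>\<Prod> (1 - s z)\<close>, to which the previous lemma applies
  with \<open>r = - s\<close>.
\<close>

lemma stable_poly_minor_nonneg:
  fixes p :: "complex poly"
  assumes monic: "lead_coeff p = 1" and deg: "degree p \<ge> 3"
    and roots: "\<And>s. poly p s = 0 \<Longrightarrow> Re s \<le> 0"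
  defines "e \<equiv> \<lambda>k. coeff p (degree p - k)"
  shows "(Im (e 2))\<^sup>2 \<le> Re (e 1) * (Re (e 2 * cnj (e 1)) - Re (e 3))"
proof -
  obtain ss where "Polynomial.smult (coeff p (degree p)) (\<Prod>s\<leftarrow>ss. [:- s, 1:]) = p"
    using fundamental_theorem_algebra_factorized by blast
  hence p: "p = (\<Prod>s\<leftarrow>ss. [:- s, 1:])" using monic by simp
  have "Re s \<le> 0" if "s \<in> set ss" for s
    using that by (intro roots) (auto simp: p poly_prod_list prod_list_zero_iff o_def)
  moreover have "reflect_poly [:- s, 1:] = [:1, - s:]" for s :: complex
    by (cases "s = 0") (simp_all add: reflect_poly_pCons reflect_poly_def)
  hence "reflect_poly p = (\<Prod>r\<leftarrow>map uminus ss. [:1, r:])"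
    by (simp add: p reflect_poly_prod_list o_def)
  moreover have "coeff (reflect_poly p) k = e k" if "k \<le> 3" for k
    using deg that by (simp add: coeff_reflect_poly e_def)
  ultimately show ?thesis using hermite_minor_nonneg[of "map uminus ss"] by force
qed

text \<open>
  The smallness conditions restrict \<open>Re \<mu>\<close> only. They make the Hermite minor negative for every
  \<open>\<mu> \<noteq> 0\<close>, so the roots cannot all lie in the closed left half-plane.
\<close>

lemma consensus_poly_unstable_root:
  fixes a :: "nat \<Rightarrow> real" and \<mu> :: complex
  assumes n: "n \<ge> 3" and a: "\<And>k. k < n \<Longrightarrow> a k > 0"
    and small: "Re \<mu> * (a (n - 1))\<^sup>2 < a (n - 2)" "Re \<mu> * a (n - 1) * a (n - 2) < a (n - 3)"
  shows "\<exists>s. Re s \<ge> 0 \<and> s ^ n + \<mu> * (\<Sum>k = 0..n - 1. complex_of_real (a k) * s ^ k) = 0"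
proof (cases "\<mu> = 0")
  case True
  thus ?thesis using n by (intro exI[of _ 0]) simp
next
  case False
  define p where "p = monom 1 n + (\<Sum>k = 0..n - 1. monom (\<mu> * complex_of_real (a k)) k)"
  have coeff_p: "coeff p k = (if k = n then 1 else if k < n then \<mu> * complex_of_real (a k) else 0)" for k
    using n by (auto simp: p_def coeff_sum)
  have deg: "degree p = n"
    by (rule antisym) (auto intro!: degree_le le_degree simp: coeff_p)
  have poly_p: "poly p s = s ^ n + \<mu> * (\<Sum>k = 0..n - 1. complex_of_real (a k) * s ^ k)" for s
    by (simp add: p_def poly_monom poly_sum sum_distrib_left mult.assoc)
  let ?c1 = "a (n - 1)" and ?c2 = "a (n - 2)" and ?c3 = "a (n - 3)"
  have pos: "?c1 > 0" "?c2 > 0" "?c3 > 0" using a n by auto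
  show ?thesis
  proof (rule ccontr)
    assume "\<not> ?thesis"
    hence "\<And>s. poly p s = 0 \<Longrightarrow> Re s \<le> 0" unfolding poly_p by (metis linear)
    moreover have "coeff p (n - 1) = \<mu> * complex_of_real ?c1" "coeff p (n - 2) = \<mu> * complex_of_real ?c2"
      "coeff p (n - 3) = \<mu> * complex_of_real ?c3" "coeff p n = 1"
      using n by (simp_all add: coeff_p)
    ultimately have "(Im (\<mu> * complex_of_real ?c2))\<^sup>2 \<le> Re (\<mu> * complex_of_real ?c1) *
      (Re (\<mu> * complex_of_real ?c2 * cnj (\<mu> * complex_of_real ?c1)) - Re (\<mu> * complex_of_real ?c3))"
      using stable_poly_minor_nonneg[of p] n unfolding deg by simp
    hence "(Im \<mu> * ?c2)\<^sup>2 \<le> Re \<mu> * ?c1 * (((Re \<mu>)\<^sup>2 + (Im \<mu>)\<^sup>2) * ?c1 * ?c2 - Re \<mu> * ?c3)"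
      by (simp add: power2_eq_square algebra_simps)
    hence "0 \<le> (Re \<mu>)\<^sup>2 * (?c1 * (Re \<mu> * ?c1 * ?c2 - ?c3)) + (Im \<mu>)\<^sup>2 * (?c2 * (Re \<mu> * ?c1\<^sup>2 - ?c2))"
      by (simp add: power2_eq_square algebra_simps)
    moreover have "?c1 * (Re \<mu> * ?c1 * ?c2 - ?c3) < 0" "?c2 * (Re \<mu> * ?c1\<^sup>2 - ?c2) < 0"
      using small pos by (auto intro: mult_pos_neg)
    moreover have "Re \<mu> \<noteq> 0 \<or> Im \<mu> \<noteq> 0" using False by (simp add: complex_eq_iff)
    hence "(Re \<mu>)\<^sup>2 > 0 \<or> (Im \<mu>)\<^sup>2 > 0" by simp
    ultimately show False
      by (smt (verit) mult_pos_neg mult_nonneg_nonpos zero_le_power2)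
  qed
qed

section \<open>Modal trajectories\<close>

lemma modal_trajectory:
  assumes wf: "wf_weighted_digraph G" and n: "n \<ge> 1"
    and v: "\<And>i. i < size_of G \<Longrightarrow>
      (\<Sum>j\<in>nbrs G i. complex_of_real (weight G i j) * (v i - v j)) = \<mu> * v i"
    and s: "s ^ n + \<mu> * (\<Sum>k = 0..n - 1. complex_of_real (a k) * s ^ k) = 0"
  shows "closed_loop n (consensus_control n a) G (\<lambda>t i k. Re (s ^ k * exp (s * of_real t) * v i))"
proof -
  define x where "x t i k = Re (s ^ k * exp (s * of_real t) * v i)" for t i k
  have deriv: "((\<lambda>t. x t i k) has_real_derivative x t i (Suc k)) (at t within {0..})" for t i k
  proof -
    have "((\<lambda>z. s ^ k * exp (s * z) * v i) has_field_derivative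
        s ^ Suc k * exp (s * of_real t) * v i) (at (of_real t))"
      by (auto intro!: derivative_eq_intros)
    from has_vector_derivative_real_field[OF this, of "{0..}"]
    show ?thesis
      unfolding x_def has_real_derivative_iff_has_vector_derivative 
      by (rule bounded_linear.has_vector_derivative[OF bounded_linear_Re])
  qed
  have input: "consensus_control n a G (x t) i = x t i n" if i: "i < size_of G" for t i
  proof -
    let ?E = "exp (s * of_real t)"
    have diff: "(\<Sum>j\<in>nbrs G i. weight G i j * (x t i k - x t j k)) = Re (s ^ k * ?E * (\<mu> * v i))" for k
    proof -
      have "s ^ k * ?E * (\<mu> * v i) =
        (\<Sum>j\<in>nbrs G i. complex_of_real (weight G i j) * (s ^ k * ?E * v i - s ^ k * ?E * v j))"
        unfolding v[OF i, symmetric] sum_distrib_left by (intro sum.cong) (auto simp: algebra_simps)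
      also have "Re \<dots> = (\<Sum>j\<in>nbrs G i. weight G i j * (x t i k - x t j k))"
        unfolding Re_sum by (intro sum.cong) (auto simp: x_def)
      finally show ?thesis by simp
    qed
    have "consensus_control n a G (x t) i = - (\<Sum>k = 0..n - 1. a k * Re (s ^ k * ?E * (\<mu> * v i)))"
      unfolding consensus_control_def diff ..
    also have "\<dots> = Re (- (\<Sum>k = 0..n - 1. complex_of_real (a k) * (s ^ k * ?E * (\<mu> * v i))))"
      unfolding uminus_complex.sel Re_sum by simp
    also have "(\<Sum>k = 0..n - 1. complex_of_real (a k) * (s ^ k * ?E * (\<mu> * v i))) =
      \<mu> * (\<Sum>k = 0..n - 1. complex_of_real (a k) * s ^ k) * (?E * v i)"
      by (simp add: sum_distrib_left sum_distrib_right mult_ac)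
    also have "\<mu> * (\<Sum>k = 0..n - 1. complex_of_real (a k) * s ^ k) = - (s ^ n)"
      using s by (simp add: eq_neg_iff_add_eq_0 add.commute)
    finally show ?thesis by (simp add: x_def[of t i n] mult.assoc del: times_complex.sel)
  qed
  have nodes: "nodes G = {..<size_of G}" using wf by (simp add: wf_weighted_digraph_def)
  have "closed_loop n (consensus_control n a) G x"
    unfolding closed_loop_def nodes
  proof (intro ballI allI impI conjI)
    fix i t
    assume "i \<in> {..<size_of G}"
    thus "((\<lambda>s. x s i (n - 1)) has_real_derivative consensus_control n a G (x t) i) (at t within {0..})"
      using deriv[of i "n - 1" t] n input by simp
  qed (use deriv in simp)
  thus ?thesis unfolding x_def .
qed

text \<open>
  A single real mode may agree at two nodes although \<open>v\<close> does not, since only the real part is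
  seen. Both \<open>v\<close> and \<open>- \<i> v\<close> are eigenvectors, and together they control the complex difference
  \<open>exp (s t) (v\<^sub>i - v\<^sub>j)\<close>, whose modulus is bounded below when \<open>Re s \<ge> 0\<close>.
\<close>

lemma no_consensus_if_unstable_mode:
  assumes wf: "wf_weighted_digraph G" and n: "n \<ge> 1"
    and v: "\<And>i. i < size_of G \<Longrightarrow>
      (\<Sum>j\<in>nbrs G i. complex_of_real (weight G i j) * (v i - v j)) = \<mu> * v i"
    and nc: "\<exists>i<size_of G. \<exists>j<size_of G. v i \<noteq> v j"
    and s: "s ^ n + \<mu> * (\<Sum>k = 0..n - 1. complex_of_real (a k) * s ^ k) = 0" "Re s \<ge> 0"
  shows "\<not> achieves_consensus n (consensus_control n a) G"
proof
  assume cons: "achieves_consensus n (consensus_control n a) G"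
  obtain i j where ij: "i < size_of G" "j < size_of G" "v i \<noteq> v j" using nc by blast
  have nodes: "nodes G = {..<size_of G}" using wf by (simp add: wf_weighted_digraph_def)
  define z where "z t = exp (s * of_real t) * (v i - v j)" for t :: real
  have lim: "((\<lambda>t. Re (b * z t)) \<longlongrightarrow> 0) at_top" for b
  proof -
    have "(\<Sum>j\<in>nbrs G i. complex_of_real (weight G i j) * (b * v i - b * v j)) = \<mu> * (b * v i)"
      if "i < size_of G" for i
      using arg_cong[OF v[OF that], of "(*) b"] by (simp add: sum_distrib_left algebra_simps)
    from modal_trajectory[OF wf n this s(1)]
    have "closed_loop n (consensus_control n a) G
      (\<lambda>t i k. Re (s ^ k * exp (s * of_real t) * (b * v i)))" by simp
    with cons ij n nodes
    have "((\<lambda>t. Re (s ^ 0 * exp (s * of_real t) * (b * v i)) -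
        Re (s ^ 0 * exp (s * of_real t) * (b * v j))) \<longlongrightarrow> 0) at_top"
      unfolding achieves_consensus_def by fastforce
    moreover have "Re (s ^ 0 * exp (s * of_real t) * (b * v i)) -
        Re (s ^ 0 * exp (s * of_real t) * (b * v j)) = Re (b * z t)" for t
      unfolding minus_complex.sel[symmetric] z_def by (simp only: power_0) (simp add: algebra_simps)
    ultimately show ?thesis by simp
  qed
  have "(z \<longlongrightarrow> 0) at_top"
    using lim[of 1] lim[of "- \<i>"] by (intro tendsto_complex_iff[THEN iffD2]) simp
  hence "((\<lambda>t. norm (z t)) \<longlongrightarrow> 0) at_top" by (rule tendsto_norm_zero)
  moreover have "\<forall>\<^sub>F t in at_top. norm (v i - v j) \<le> norm (z t)"
    using eventually_ge_at_top[of "0 :: real"]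
  proof eventually_elim
    case (elim t)
    have "1 * norm (v i - v j) \<le> norm (exp (s * of_real t)) * norm (v i - v j)"
      using elim s(2) by (intro mult_right_mono) (auto simp: norm_exp_eq_Re)
    thus ?case by (simp add: z_def norm_mult)
  qed
  ultimately have "norm (v i - v j) \<le> 0"
    by (rule tendsto_lowerbound) simp
  thus False using ij by simp
qed

section \<open>Failure of scalable stability\<close>

theorem theorem3p1:
  fixes n :: nat
    and \<G> :: "nat \<Rightarrow> weighted_digraph"
    and eig :: "nat \<Rightarrow> nat \<Rightarrow> complex"
  assumes "n \<ge> 3"
    and "graph_family \<G>"
    and "\<And>m. laplacian_eigenvalues (\<G> m) (eig m)"
    and "(\<lambda>m. Re (eig m 2)) \<longlonglongrightarrow> 0"
  shows "\<not> (\<exists>a :: nat \<Rightarrow> real.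
            (\<forall>k \<in> {0..n - 1}. a k > 0) \<and> scalably_stable n (consensus_control n a) \<G>)"
proof
  assume "\<exists>a :: nat \<Rightarrow> real.
    (\<forall>k \<in> {0..n - 1}. a k > 0) \<and> scalably_stable n (consensus_control n a) \<G>"
  then obtain a :: "nat \<Rightarrow> real" where a_all: "\<forall>k \<in> {0..n - 1}. a k > 0"
    and stable: "\<And>m. achieves_consensus n (consensus_control n a) (\<G> m)"
    unfolding scalably_stable_def by blast
  have a: "a k > 0" if "k < n" for k using a_all that by simp
  have pos: "a (n - 2) > 0" "a (n - 3) > 0" using a assms(1) by auto
  have wf: "wf_weighted_digraph (\<G> m)" for m using assms(2) by (simp add: graph_family_def)
  have "strict_mono (\<lambda>m. size_of (\<G> m))" using assms(2) by (simp add: graph_family_def)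
  \<comment> \<open>Growth of the family provides at least two nodes, so that \<open>eig m 2\<close> is an actual eigenvalue.\<close>
  hence size: "m \<le> size_of (\<G> m)" for m by (rule strict_mono_imp_increasing)
  have lims: "(\<lambda>m. Re (eig m 2) * (a (n - 1))\<^sup>2) \<longlonglongrightarrow> 0 * (a (n - 1))\<^sup>2"
    "(\<lambda>m. Re (eig m 2) * a (n - 1) * a (n - 2)) \<longlonglongrightarrow> 0 * a (n - 1) * a (n - 2)"
    by (intro tendsto_intros assms(4))+
  have "\<forall>\<^sub>F m in sequentially. Re (eig m 2) * (a (n - 1))\<^sup>2 < a (n - 2)"
    "\<forall>\<^sub>F m in sequentially. Re (eig m 2) * a (n - 1) * a (n - 2) < a (n - 3)"
    using order_tendstoD(2)[OF lims(1)] order_tendstoD(2)[OF lims(2)] pos by auto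
  hence "\<forall>\<^sub>F m in sequentially. m \<ge> 2 \<and> Re (eig m 2) * (a (n - 1))\<^sup>2 < a (n - 2) \<and>
    Re (eig m 2) * a (n - 1) * a (n - 2) < a (n - 3)"
    using eventually_ge_at_top[of 2] by eventually_elim simp
  then obtain m where m: "m \<ge> 2" "Re (eig m 2) * (a (n - 1))\<^sup>2 < a (n - 2)"
    "Re (eig m 2) * a (n - 1) * a (n - 2) < a (n - 3)"
    by (auto dest: eventually_happens)
  have N: "size_of (\<G> m) \<ge> 2" using m(1) size[of m] by simp
  obtain s where s: "Re s \<ge> 0"
    "s ^ n + eig m 2 * (\<Sum>k = 0..n - 1. complex_of_real (a k) * s ^ k) = 0"
    using consensus_poly_unstable_root[OF assms(1) a m(2,3)] by blast
  obtain v where "\<And>i. i < size_of (\<G> m) \<Longrightarrow>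
      (\<Sum>j\<in>nbrs (\<G> m) i. complex_of_real (weight (\<G> m) i j) * (v i - v j)) = eig m 2 * v i"
    and "\<exists>i<size_of (\<G> m). \<exists>j<size_of (\<G> m). v i \<noteq> v j"
    using nonconstant_laplacian_eigenvector[OF wf N assms(3)] by blast
  from no_consensus_if_unstable_mode[OF wf _ this s(2,1)] stable assms(1)
  show False by simp
qed

end
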